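(* For every $\delta < 1$ there is a constant $c > 0$ such that for every $n$ and every integer $m$ with $cn \le m \le n^2/c$, there exists a graph $G$ with $n$ vertices and $m$ edges that is $\delta$-asymmetric.
   Context: All graphs are simple, undirected and labeled. For two labeled graphs $G,H$ on the same $n$-vertex set, $dist(G,H)$ is half the Hamming distance between their adjacency matrices (equivalently, when $G,H$ have the same number of edges, the number of vertex pairs that are edges of $G$ but not of $H$). For a permutation $\pi$ of the vertex set, $G_\pi$ is the graph obtained by applying $\pi$ to the vertices of $G$. A $k$-permutation of an $n$-element set is a permutation that moves exactly $k$ elements and fixes the other $n-k$. For $\delta>0$, a graph $G$ with $n$ vertices and $m$ edges is $\delta$-asymmetric if for every $1 \le k \le n$ and every $k$-permutation $\pi$ of its vertices, $dist(G,G_\pi) \ge \delta \frac{k}{n} m$. *)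

theory Defs
  imports Complex_Main "HOL-Combinatorics.Permutations"
begin

definition vertex_pairs :: "'a set \<Rightarrow> 'a set set" where
  "vertex_pairs V = {e. e \<subseteq> V \<and> card e = 2}"

definition simple_graph :: "'a set \<Rightarrow> 'a set set \<Rightarrow> bool" where
  "simple_graph V E \<longleftrightarrow> finite V \<and> E \<subseteq> vertex_pairs V"

definition adjacency :: "'a set set \<Rightarrow> 'a set \<Rightarrow> nat" where
  "adjacency E e = (if e \<in> E then 1 else 0)"

(* The Hamming distance of the adjacency matrices has one position for each unordered pair of
   vertices (the matrices are symmetric with zero diagonal). With this count, half the Hamming
   distance of two graphs with equally many edges is the number of pairs that are edges of the
   first but not of the second: see graph_dist_eq_card_diff. Counting both (u,v) and (v,u) would
   double the distance. *)
definition graph_dist :: "'a set \<Rightarrow> 'a set set \<Rightarrow> 'a set set \<Rightarrow> real" where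
  "graph_dist V E F = real (card {e \<in> vertex_pairs V. adjacency E e \<noteq> adjacency F e}) / 2"

definition permute_graph :: "('a \<Rightarrow> 'a) \<Rightarrow> 'a set set \<Rightarrow> 'a set set" where
  "permute_graph \<pi> E = (\<lambda>e. \<pi> ` e) ` E"

definition k_permutation :: "nat \<Rightarrow> 'a set \<Rightarrow> ('a \<Rightarrow> 'a) \<Rightarrow> bool" where
  "k_permutation k V \<pi> \<longleftrightarrow> \<pi> permutes V \<and> card {v \<in> V. \<pi> v \<noteq> v} = k"

definition asymmetric_graph :: "real \<Rightarrow> 'a set \<Rightarrow> 'a set set \<Rightarrow> bool" where
  "asymmetric_graph \<delta> V E \<longleftrightarrow>
     (\<forall>k \<in> {1..card V}. \<forall>\<pi>. k_permutation k V \<pi> \<longrightarrow>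
        graph_dist V E (permute_graph \<pi> E) \<ge> \<delta> * (real k / real (card V)) * real (card E))"

lemma graph_dist_eq_card_diff:
  assumes "simple_graph V E" "simple_graph V F" "card E = card F"
  shows "graph_dist V E F = real (card (E - F))"
proof -
  have sub: "E \<subseteq> vertex_pairs V" "F \<subseteq> vertex_pairs V" and "finite (vertex_pairs V)"
    using assms by (auto simp: simple_graph_def vertex_pairs_def)
  then have fin: "finite E" "finite F"
    by (auto intro: finite_subset)
  have "{e \<in> vertex_pairs V. adjacency E e \<noteq> adjacency F e} = (E - F) \<union> (F - E)"
    using sub by (auto simp: adjacency_def)
  moreover have "card ((E - F) \<union> (F - E)) = card (E - F) + card (F - E)"
    using fin by (intro card_Un_disjoint) auto
  moreover have "card (F - E) = card (E - F)"
    using fin assms(3) by (simp add: card_Diff_subset_Int Int_commute)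
  ultimately show ?thesis
    by (simp add: graph_dist_def)
qed

lemma simple_graph_permute_graph:
  assumes "simple_graph V E" "\<pi> permutes V"
  shows "simple_graph V (permute_graph \<pi> E)" "card (permute_graph \<pi> E) = card E"
proof -
  have inj: "inj \<pi>" using assms(2) by (rule permutes_inj)
  show "simple_graph V (permute_graph \<pi> E)"
    using assms inj unfolding simple_graph_def vertex_pairs_def permute_graph_def
    by (auto simp: permutes_in_image card_image inj_on_subset subset_iff)
  show "card (permute_graph \<pi> E) = card E"
    unfolding permute_graph_def using inj
    by (intro card_image) (auto simp: inj_on_def inj_image_eq_iff)
qed

end

theory Submission
  imports Defs
begin

text \<open>Orient the complete graph so that each vertex owns about $n/2$ of its pairs, split the pairs owned
  by a vertex into blocks of size $b \approx n^2/(4m)$, and pick one pair at random from each of $m$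
  blocks, so that every vertex owns at least $r = \lfloor m/n \rfloor$ edges. If $\pi$ moves $k$
  vertices, these own at least $rk$ edges, and it suffices that at most $\epsilon r k$ of them are
  mapped into the graph. Otherwise, apart from the at most $k$ swapped pairs, there is a set $P$ of
  $t \approx \epsilon r k/6$ owned edges disjoint from $\pi(P)$ with $\pi(P)$ also in the graph, which
  has probability at most $\binom{(r+1)kb}{t} b^{-2t} = O(1/(\epsilon b))^t \le n^{-4k}$. As there are
  at most $n^{2k}$ such $\pi$, a union bound over all $k$ leaves a good choice. Owning at least $r$
  edges excludes the vertices of small degree that defeat this argument for a uniformly random graph
  of constant average degree.\<close>

section \<open>Independent subsets under an injection, and choices from disjoint blocks\<close>

lemma inj_fixpoint_free_independent_third:
  assumes "finite P" "inj f" "\<And>x. x \<in> P \<Longrightarrow> f x \<noteq> x"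
  shows "\<exists>R\<subseteq>P. R \<inter> f ` R = {} \<and> card P \<le> 3 * card R"
proof -
  let ?C = "{R. R \<subseteq> P \<and> R \<inter> f ` R = {}}"
  have "finite ?C" using assms(1) by simp
  moreover have "{} \<in> ?C" by simp
  ultimately obtain R where R: "R \<in> ?C" and max: "\<And>R'. R' \<in> ?C \<Longrightarrow> R \<subseteq> R' \<Longrightarrow> R = R'"
    using finite_has_maximal[of ?C] by (metis (no_types, lifting) empty_iff)
  have fR: "finite R" using R assms(1) finite_subset by blast
  have "P - R \<subseteq> f ` R \<union> f -` R"
  proof
    fix x assume x: "x \<in> P - R"
    have "insert x R \<notin> ?C" using max[of "insert x R"] x by blast
    then show "x \<in> f ` R \<union> f -` R"
      using x R assms(3)[of x] by auto
  qed
  moreover have fin: "finite (f ` R \<union> f -` R)"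
    using fR assms(2) by (simp add: finite_vimageI)
  ultimately have "card (P - R) \<le> card (f ` R \<union> f -` R)"
    by (rule card_mono[rotated])
  also have "\<dots> \<le> card (f ` R) + card (f -` R)" by (rule card_Un_le)
  also have "\<dots> \<le> card R + card R"
    by (intro add_mono card_image_le fR card_vimage_inj_on_le[of f UNIV, simplified] assms)
  finally have "card (P - R) \<le> 2 * card R" by simp
  moreover have "card P = card R + card (P - R)"
    using R assms(1) by (metis (mono_tags, lifting) card_Diff_subset card_mono finite_subset le_add_diff_inverse mem_Collect_eq)
  ultimately show ?thesis using R by (intro exI[of _ R]) auto
qed

lemma inj_on_choice:
  assumes "inj_on (\<lambda>(i, x). e i x) (I \<times> X)" "w \<in> I \<rightarrow>\<^sub>E X"
  shows "inj_on (\<lambda>i. e i (w i)) I"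
proof (rule inj_onI)
  fix i j assume "i \<in> I" "j \<in> I" "e i (w i) = e j (w j)"
  then show "i = j" using inj_onD[OF assms(1), of "(i, w i)" "(j, w j)"] assms(2) by auto
qed

text \<open>Injectivity of \<open>e\<close> makes the blocks disjoint, so each element of
  \<open>W\<close> fixes both the index that selects it and the selected value. Either no choice
  contains \<open>W\<close>, or \<open>card W\<close> coordinates are forced: the probability bound
  \<open>card X\<close> to the power \<open>- card W\<close>, multiplied out to stay in the
  naturals.\<close>

lemma card_choices_containing:
  assumes "finite I" "finite X" and inj: "inj_on (\<lambda>(i, x). e i x) (I \<times> X)"
  shows "card {w \<in> I \<rightarrow>\<^sub>E X. W \<subseteq> (\<lambda>i. e i (w i)) ` I} * card X ^ card W \<le> card X ^ card I"
    (is "card ?A * _ \<le> _")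
proof (cases "?A = {}")
  case False
  then obtain v where v: "v \<in> I \<rightarrow>\<^sub>E X" "W \<subseteq> (\<lambda>i. e i (v i)) ` I" by blast
  define J where "J = {i \<in> I. e i (v i) \<in> W}"
  have "inj_on (\<lambda>i. e i (v i)) J"
    using inj_on_choice[OF inj v(1)] by (rule inj_on_subset) (auto simp: J_def)
  moreover have "(\<lambda>i. e i (v i)) ` J = W" using v unfolding J_def by auto
  ultimately have cW: "card W = card J" using card_image by metis
  have JI: "J \<subseteq> I" unfolding J_def by auto
  have agree: "w i = v i" if w: "w \<in> ?A" and i: "i \<in> J" for w i
  proof -
    obtain j where j: "j \<in> I" "e i (v i) = e j (w j)"
      using w i unfolding J_def by blast
    have "i \<in> I" "v i \<in> X" "w j \<in> X" using w v(1) i j JI by (auto simp: PiE_iff)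
    then show ?thesis
      using inj_onD[OF inj, of "(i, v i)" "(j, w j)"] j by auto
  qed
  let ?R = "\<lambda>w. restrict w (I - J)"
  have "inj_on ?R ?A"
  proof (rule inj_onI)
    fix w w' assume w: "w \<in> ?A" "w' \<in> ?A" and eq: "?R w = ?R w'"
    show "w = w'"
    proof
      fix i
      show "w i = w' i"
        using agree[OF w(1), of i] agree[OF w(2), of i] fun_cong[OF eq, of i] w
        by (cases "i \<in> J"; cases "i \<in> I") (auto simp: PiE_iff extensional_def)
    qed
  qed
  moreover have "?R ` ?A \<subseteq> (I - J) \<rightarrow>\<^sub>E X"
    by (intro image_subsetI restrict_PiE_iff[THEN iffD2]) (auto simp: PiE_iff)
  ultimately have "card ?A \<le> card ((I - J) \<rightarrow>\<^sub>E X)"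
    by (intro card_inj_on_le) (auto intro!: finite_PiE assms)
  also have "\<dots> = card X ^ (card I - card J)"
    using assms JI by (simp add: card_PiE card_Diff_subset finite_subset)
  finally have "card ?A * card X ^ card W \<le> card X ^ (card I - card J) * card X ^ card J"
    unfolding cW by (rule mult_right_mono) simp
  also have "\<dots> = card X ^ card I"
    using card_mono[OF assms(1) JI] by (simp flip: power_add)
  finally show ?thesis .
next
  case True
  show ?thesis unfolding True by simp
qed

section \<open>Counting permutations, and a binomial estimate\<close>

lemma finite_k_permutations:
  assumes "finite V"
  shows "finite {\<pi>. k_permutation k V \<pi>}"
  by (rule finite_subset[OF _ finite_permutations[OF assms]]) (auto simp: k_permutation_def)

text \<open>A permutation is determined by its graph on the moved points, a $k$-subset of $V \times V$.\<close>

lemma card_k_permutations_le: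
  assumes "finite V"
  shows "card {\<pi>. k_permutation k V \<pi>} \<le> card V ^ (2 * k)"
proof -
  let ?g = "\<lambda>\<pi>. (\<lambda>v. (v, \<pi> v)) ` {v \<in> V. \<pi> v \<noteq> v}"
  let ?T = "{A. A \<subseteq> V \<times> V \<and> card A = k}"
  have "inj_on ?g {\<pi>. k_permutation k V \<pi>}"
  proof (rule inj_onI)
    fix p q assume p: "p \<in> {\<pi>. k_permutation k V \<pi>}" and q: "q \<in> {\<pi>. k_permutation k V \<pi>}"
      and eq: "?g p = ?g q"
    show "p = q"
    proof
      fix v
      have mem: "(v, y) \<in> ?g r \<longleftrightarrow> v \<in> V \<and> r v \<noteq> v \<and> y = r v" for r y by auto
      show "p v = q v"
        using p q mem[of "p v" p] mem[of "p v" q] mem[of "q v" p] mem[of "q v" q] eq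
        by (cases "v \<in> V") (auto simp: k_permutation_def permutes_def)
    qed
  qed
  moreover have "?g ` {\<pi>. k_permutation k V \<pi>} \<subseteq> ?T"
  proof
    fix A assume "A \<in> ?g ` {\<pi>. k_permutation k V \<pi>}"
    then obtain p where p: "p permutes V" "card {v \<in> V. p v \<noteq> v} = k" and A: "A = ?g p"
      by (auto simp: k_permutation_def)
    have "card A = k" unfolding A using p(2) by (subst card_image) (auto simp: inj_on_def)
    then show "A \<in> ?T" using p(1) unfolding A by (auto simp: permutes_in_image)
  qed
  moreover have "finite ?T" using assms by simp
  ultimately have "card {\<pi>. k_permutation k V \<pi>} \<le> card ?T"
    by (rule card_inj_on_le)
  also have "\<dots> = (card V * card V) choose k"
    using assms by (simp add: n_subsets card_cartesian_product)
  also have "\<dots> \<le> (card V * card V) ^ k"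
  proof (cases "k \<le> card V * card V")
    case True then show ?thesis by (rule binomial_le_pow)
  qed (simp add: binomial_eq_0)
  finally show ?thesis by (simp add: power_mult power2_eq_square)
qed

text \<open>The term of index \<open>t\<close> in the series of \<open>exp t\<close> gives
  \<open>t ^ t / fact t \<le> exp t\<close>; combine this with
  \<open>(N choose t) * fact t \<le> N ^ t\<close>.\<close>

lemma binomial_le_exp_pow:
  assumes "t > 0"
  shows "real (N choose t) \<le> (exp 1 * real N / real t) ^ t"
proof -
  have "real t ^ t / fact t \<le> exp (real t)"
  proof -
    have "(\<Sum>i\<in>{t}. real t ^ i / fact i) \<le> (\<Sum>i. real t ^ i / fact i)"
      using summable_exp[of "real t"]
      by (intro sum_le_suminf) (auto simp: field_simps)
    then show ?thesis by (simp add: exp_def field_simps scaleR_conv_of_real)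
  qed
  then have "real t ^ t \<le> exp 1 ^ t * fact t"
    by (simp add: field_simps exp_of_nat_mult[of t 1, simplified])
  moreover have "real (N choose t) * fact t \<le> real N ^ t"
    using binomial_fact_pow[of N t] by (metis of_nat_fact of_nat_le_iff of_nat_mult of_nat_power)
  ultimately have "real t ^ t * (real (N choose t) * fact t) \<le> (exp 1 ^ t * fact t) * real N ^ t"
    by (intro mult_mono) auto
  then have "real t ^ t * real (N choose t) \<le> exp 1 ^ t * real N ^ t"
    by (simp add: mult.assoc mult.left_commute[of _ "fact t"] mult.commute[of _ "fact t"])
  then show ?thesis using assms
    by (simp add: power_divide power_mult_distrib field_simps)
qed

section \<open>The cyclic orientation, its blocks and the graphs chosen from them\<close>

text \<open>Slot $s$ belongs to vertex $s \bmod n$ and to its block number $\lfloor s/n \rfloor$; the $x$-th pair of that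
  block joins the vertex to the one lying $\lfloor s/n \rfloor b + x + 1 < n/2$ places further on the cycle.\<close>

definition slot_pair :: "nat \<Rightarrow> nat \<Rightarrow> nat \<Rightarrow> nat \<Rightarrow> nat set" where
  "slot_pair n b s x = {s mod n, (s mod n + (s div n * b + x + 1)) mod n}"

definition slot_graph :: "nat \<Rightarrow> nat \<Rightarrow> nat \<Rightarrow> (nat \<Rightarrow> nat) \<Rightarrow> nat set set" where
  "slot_graph n m b w = (\<lambda>s. slot_pair n b s (w s)) ` {..<m}"

definition slots_of :: "nat \<Rightarrow> nat \<Rightarrow> nat set \<Rightarrow> nat set" where
  "slots_of n m S = {s. s < m \<and> s mod n \<in> S}"

text \<open>The possible edges owned by \<open>S\<close>, taken over all choices at once. A set that
  does not depend on \<open>w\<close> is what a union bound over its subsets requires.\<close>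

definition pairs_of :: "nat \<Rightarrow> nat \<Rightarrow> nat \<Rightarrow> nat set \<Rightarrow> nat set set" where
  "pairs_of n m b S = (\<lambda>(s, x). slot_pair n b s x) ` (slots_of n m S \<times> {..<b})"

lemma mod_add_eq_if:
  fixes n :: nat
  assumes "a < n" "d < n"
  shows "(a + d) mod n = (if a + d < n then a + d else a + d - n)"
  using assms by (auto simp: mod_if)

text \<open>Seen from its other end, a step \<open>j < n/2\<close> around the cycle has length
  \<open>n - j > n/2\<close>. So a pair has only one owner; strictness matters for even
  \<open>n\<close>, where an antipodal pair would have two.\<close>

lemma mod_step_inj:
  fixes n :: nat
  assumes "i < n" "i' < n" "0 < j" "0 < j'" "2 * j < n" "2 * j' < n"
    and "{i, (i + j) mod n} = {i', (i' + j') mod n}"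
  shows "i = i' \<and> j = j'"
  using assms mod_add_eq_if[of i n j] mod_add_eq_if[of i' n j']
  by (auto simp: doubleton_eq_iff split: if_splits)

text \<open>Slots below \<open>m\<close> have block numbers at most \<open>m div n\<close>. The
  first assumption says that \<open>Suc (m div n)\<close> consecutive blocks of length
  \<open>b\<close> fit into fewer than \<open>n/2\<close> steps.\<close>

lemma slot_offset_bounds:
  fixes n m b :: nat
  assumes "2 * (Suc (m div n) * b) < n" "s < m" "x < b"
  shows "2 * (s div n * b + x + 1) < n"
proof -
  have "s div n \<le> m div n" using assms by (intro div_le_mono) simp
  then have "s div n * b \<le> m div n * b" by (rule mult_right_mono) simp
  then have "s div n * b + x + 1 \<le> Suc (m div n) * b"
    using assms(3) unfolding mult_Suc by linarith
  then have "2 * (s div n * b + x + 1) \<le> 2 * (Suc (m div n) * b)" by (rule mult_le_mono2)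
  then show ?thesis using assms(1) by (rule le_less_trans)
qed

text \<open>The pair determines its owner and its step by \<open>mod_step_inj\<close>; as
  \<open>x < b\<close>, division of the step minus one by \<open>b\<close> returns the block number
  and \<open>x\<close>.\<close>

lemma inj_on_slot_pair:
  assumes b: "2 * (Suc (m div n) * b) < n"
  shows "inj_on (\<lambda>(s, x). slot_pair n b s x) ({..<m} \<times> {..<b})"
proof -
  have "s = s' \<and> x = x'"
    if *: "s < m" "x < b" "s' < m" "x' < b" and eq: "slot_pair n b s x = slot_pair n b s' x'" for s x s' x'
  proof -
    note bd = slot_offset_bounds[OF b *(1,2)] slot_offset_bounds[OF b *(3,4)]
    have n: "s mod n < n" "s' mod n < n" using bd by auto
    have "s mod n = s' mod n \<and> s div n * b + x + 1 = s' div n * b + x' + 1"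
      by (rule mod_step_inj[OF n _ _ bd eq[unfolded slot_pair_def]]) simp_all
    then have eqs: "s mod n = s' mod n" "s div n * b + x = s' div n * b + x'" by auto
    have "s div n = (s div n * b + x) div b" "x = (s div n * b + x) mod b"
      "s' div n = (s' div n * b + x') div b" "x' = (s' div n * b + x') mod b"
      using * by auto
    then have "s div n = s' div n" "x = x'" using eqs(2) by metis+
    then show ?thesis using eqs(1) by (metis div_mult_mod_eq)
  qed
  then show ?thesis unfolding inj_on_def by auto
qed

lemma slot_pair_in_vertex_pairs:
  assumes "2 * (Suc (m div n) * b) < n" "s < m" "x < b"
  shows "slot_pair n b s x \<in> vertex_pairs {..<n}"
proof -
  let ?j = "s div n * b + x + 1"
  have j: "2 * ?j < n" using slot_offset_bounds[OF assms] .
  have n: "s mod n < n" using j by simp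
  have "(s mod n + ?j) mod n = (if s mod n + ?j < n then s mod n + ?j else s mod n + ?j - n)"
    using j by (intro mod_add_eq_if n) simp
  then have "(s mod n + ?j) mod n \<noteq> s mod n" using j n by (auto split: if_splits)
  then show ?thesis using n unfolding slot_pair_def vertex_pairs_def by auto
qed

text \<open>Blocks are disjoint, so distinct slots select distinct pairs: every choice yields
  exactly \<open>m\<close> edges and no conditioning on the edge count arises.\<close>

lemma slot_graph:
  assumes b: "2 * (Suc (m div n) * b) < n" and w: "w \<in> {..<m} \<rightarrow>\<^sub>E {..<b}"
  shows "simple_graph {..<n} (slot_graph n m b w)" "card (slot_graph n m b w) = m"
proof -
  show "simple_graph {..<n} (slot_graph n m b w)"
    using slot_pair_in_vertex_pairs[OF b] w
    by (auto simp: simple_graph_def slot_graph_def PiE_iff)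
  have "inj_on (\<lambda>s. slot_pair n b s (w s)) {..<m}"
    by (rule inj_on_choice[OF inj_on_slot_pair[OF b] w])
  then show "card (slot_graph n m b w) = m" by (simp add: slot_graph_def card_image)
qed

text \<open>Write a slot as \<open>i + n * l\<close> with \<open>i\<close> its owner. All
  \<open>l < m div n\<close> give slots below \<open>m\<close>, and none has
  \<open>l > m div n\<close>. The lower bound counts owned edges, the upper one possible owned
  pairs.\<close>

lemma card_slots_of:
  assumes n: "n > 0" and S: "S \<subseteq> {..<n}"
  shows "m div n * card S \<le> card (slots_of n m S)"
    and "card (slots_of n m S) \<le> Suc (m div n) * card S"
proof -
  let ?f = "\<lambda>(i, l). i + n * l :: nat"
  have fS: "finite S" using S finite_subset by blast
  have fin: "finite (slots_of n m S)" by (simp add: slots_of_def)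
  have "inj_on ?f (S \<times> {..<m div n})"
  proof (rule inj_onI, clarify)
    fix i l i' l' assume *: "i \<in> S" "i' \<in> S" "i + n * l = i' + n * l'"
    have "i < n" "i' < n" using S * by auto
    then show "i = i' \<and> l = l'" using *(3)
      by (metis add_left_cancel div_mult_self2 div_less add.right_neutral mod_less mod_mult_self2 n
          gr_implies_not0 add.commute add_0)
  qed
  then have "card S * (m div n) = card (?f ` (S \<times> {..<m div n}))"
    by (simp add: card_image card_cartesian_product)
  also have "\<dots> \<le> card (slots_of n m S)"
  proof (rule card_mono[OF fin], rule subsetI)
    fix s assume "s \<in> ?f ` (S \<times> {..<m div n})"
    then obtain i l where *: "i \<in> S" "l \<in> {..<m div n}" and s: "s = i + n * l" by auto
    have i: "i < n" using * S by auto
    have "n * Suc l \<le> n * (m div n)" using * by (intro mult_le_mono2) auto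
    also have "\<dots> \<le> m" by simp
    finally have "i + n * l < m" using i by simp
    then show "s \<in> slots_of n m S" using i * by (simp add: slots_of_def s)
  qed
  finally show "m div n * card S \<le> card (slots_of n m S)" by (simp add: mult.commute)
  have "slots_of n m S \<subseteq> ?f ` (S \<times> {..m div n})"
  proof
    fix s assume "s \<in> slots_of n m S"
    then have "(s mod n, s div n) \<in> S \<times> {..m div n}" "s = ?f (s mod n, s div n)"
      by (auto simp: slots_of_def intro: div_le_mono)
    then show "s \<in> ?f ` (S \<times> {..m div n})" by blast
  qed
  then have "card (slots_of n m S) \<le> card (S \<times> {..m div n})"
    using fS by (intro surj_card_le) auto
  then show "card (slots_of n m S) \<le> Suc (m div n) * card S"
    by (simp add: card_cartesian_product mult.commute)
qed

section \<open>The union bound over permutations\<close>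

text \<open>Disjointness of $P$ and $\pi(P)$ makes $2t$ distinct pairs present, whence the factor $b^{-2t}$.\<close>

definition overlap :: "nat \<Rightarrow> nat \<Rightarrow> nat \<Rightarrow> nat \<Rightarrow> (nat \<Rightarrow> nat) \<Rightarrow> (nat \<Rightarrow> nat) \<Rightarrow> bool" where
  "overlap n m b t \<pi> w \<longleftrightarrow> (\<exists>P \<subseteq> pairs_of n m b {v \<in> {..<n}. \<pi> v \<noteq> v}. card P = t \<and>
     P \<inter> (`) \<pi> ` P = {} \<and> P \<union> (`) \<pi> ` P \<subseteq> slot_graph n m b w)"

text \<open>Moved vertices own at most \<open>Suc (m div n) * k * b\<close> possible pairs. Sum over
  the \<open>t\<close>-subsets \<open>P\<close> of these; for each, the \<open>2 * t\<close> pairs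
  of \<open>P\<close> and its image are forced.\<close>

lemma card_overlap_le:
  assumes b: "2 * (Suc (m div n) * b) < n" "b > 0" and \<pi>: "k_permutation k {..<n} \<pi>"
  shows "card {w \<in> {..<m} \<rightarrow>\<^sub>E {..<b}. overlap n m b t \<pi> w} * b ^ (2 * t)
    \<le> ((Suc (m div n) * k * b) choose t) * b ^ m"
proof -
  let ?S = "{v \<in> {..<n}. \<pi> v \<noteq> v}"
  let ?Q = "pairs_of n m b ?S"
  let ?O = "{..<m} \<rightarrow>\<^sub>E {..<b}"
  let ?PP = "{P. P \<subseteq> ?Q \<and> card P = t}"
  let ?A = "\<lambda>P. {w \<in> ?O. P \<union> (`) \<pi> ` P \<subseteq> slot_graph n m b w}"
  let ?G = "{P \<in> ?PP. P \<inter> (`) \<pi> ` P = {}}"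
  have inj: "inj \<pi>" using \<pi> permutes_inj by (auto simp: k_permutation_def)
  have finQ: "finite ?Q" by (simp add: pairs_of_def slots_of_def)
  have "card ?Q \<le> card (slots_of n m ?S \<times> {..<b})"
    unfolding pairs_of_def by (rule card_image_le) (simp add: slots_of_def)
  also have "\<dots> \<le> Suc (m div n) * k * b"
    using card_slots_of(2)[of n ?S m] b(1) \<pi>
    by (auto simp: card_cartesian_product k_permutation_def)
  finally have cQ: "card ?Q \<le> Suc (m div n) * k * b" .
  have each: "card (?A P) * b ^ (2 * t) \<le> b ^ m" if "P \<in> ?G" for P
  proof -
    have P: "card P = t" "P \<inter> (`) \<pi> ` P = {}" "finite P"
      using that finQ finite_subset by auto
    have "card ((`) \<pi> ` P) = t"
      using P(1) inj by (subst card_image) (auto simp: inj_on_def inj_image_eq_iff)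
    then have "card (P \<union> (`) \<pi> ` P) = 2 * t" using P by (subst card_Un_disjoint) auto
    then show ?thesis
      using card_choices_containing[of "{..<m}" "{..<b}" "slot_pair n b" "P \<union> (`) \<pi> ` P"]
        inj_on_slot_pair[OF b(1)]
      by (simp add: slot_graph_def)
  qed
  have finG: "finite ?G" using finQ by simp
  have "{w \<in> ?O. overlap n m b t \<pi> w} \<subseteq> (\<Union>P\<in>?G. ?A P)" unfolding overlap_def by blast
  then have "card {w \<in> ?O. overlap n m b t \<pi> w} \<le> card (\<Union>P\<in>?G. ?A P)"
    using finG by (intro card_mono) (auto intro!: finite_PiE)
  also have "\<dots> \<le> (\<Sum>P\<in>?G. card (?A P))" by (rule card_UN_le[OF finG])
  finally have "card {w \<in> ?O. overlap n m b t \<pi> w} * b ^ (2 * t) \<le> (\<Sum>P\<in>?G. card (?A P) * b ^ (2 * t))"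
    by (simp add: sum_distrib_right[symmetric])
  also have "\<dots> \<le> (\<Sum>P\<in>?G. b ^ m)" by (rule sum_mono) (rule each)
  also have "\<dots> = card ?G * b ^ m" by simp
  also have "card ?G \<le> card ?PP" using finQ by (intro card_mono) auto
  also have "card ?PP = card ?Q choose t" using finQ by (simp add: n_subsets)
  also have "\<dots> \<le> (Suc (m div n) * k * b) choose t" using cQ by (rule binomial_right_mono)
  finally show ?thesis by simp
qed

text \<open>By \<open>binomial_le_exp_pow\<close>, \<open>small\<close> says that one
  \<open>k\<close>-permutation spoils at most a fraction \<open>n^(-4k)\<close> of the choices. With
  at most \<open>n^(2k)\<close> such permutations, the fractions over all \<open>k\<close> add up to
  at most \<open>1/n < 1\<close>.\<close>

lemma exists_no_overlap:
  assumes b: "2 * (Suc (m div n) * b) < n" "b > 0"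
    and t: "\<And>k. k \<in> {1..n} \<Longrightarrow> t k > 0"
    and small: "\<And>k. k \<in> {1..n} \<Longrightarrow>
      (exp 1 * real (Suc (m div n) * k * b) / real (t k) / (real b)\<^sup>2) ^ t k * real n ^ (4 * k) \<le> 1"
  shows "\<exists>w \<in> {..<m} \<rightarrow>\<^sub>E {..<b}. \<forall>k \<in> {1..n}. \<forall>\<pi>. k_permutation k {..<n} \<pi> \<longrightarrow> \<not> overlap n m b (t k) \<pi> w"
proof (rule ccontr)
  let ?O = "{..<m} \<rightarrow>\<^sub>E {..<b}"
  let ?K = "\<lambda>k. {\<pi>. k_permutation k {..<n} \<pi>}"
  let ?B = "\<lambda>k \<pi>. {w \<in> ?O. overlap n m b (t k) \<pi> w}"
  assume "\<not> ?thesis"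
  then have cover: "?O \<subseteq> (\<Union>k\<in>{1..n}. \<Union>\<pi>\<in>?K k. ?B k \<pi>)" by auto
  have finK: "finite (?K k)" for k by (rule finite_k_permutations) simp
  have n2: "n \<ge> 2" using b by (cases n) auto
  have single: "real (card (?B k \<pi>)) * real n ^ (4 * k) \<le> real b ^ m"
    if k: "k \<in> {1..n}" and \<pi>: "k_permutation k {..<n} \<pi>" for k \<pi>
  proof -
    let ?N = "Suc (m div n) * k * b"
    have "real (card (?B k \<pi>)) * real b ^ (2 * t k) \<le> real (?N choose t k) * real b ^ m"
      unfolding of_nat_power[symmetric] of_nat_mult[symmetric] of_nat_le_iff
      by (rule card_overlap_le[OF b \<pi>])
    also have "\<dots> \<le> (exp 1 * real ?N / real (t k)) ^ t k * real b ^ m"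
      by (intro mult_right_mono binomial_le_exp_pow t k) simp
    finally have "real (card (?B k \<pi>)) \<le> (exp 1 * real ?N / real (t k)) ^ t k * real b ^ m / real b ^ (2 * t k)"
      using b by (simp add: pos_le_divide_eq)
    also have "\<dots> = (exp 1 * real ?N / real (t k) / (real b)\<^sup>2) ^ t k * real b ^ m"
      by (simp only: power_divide power_mult) simp
    finally have "real (card (?B k \<pi>)) * real n ^ (4 * k)
      \<le> ((exp 1 * real ?N / real (t k) / (real b)\<^sup>2) ^ t k * real b ^ m) * real n ^ (4 * k)"
      by (rule mult_right_mono) simp
    also have "\<dots> = ((exp 1 * real ?N / real (t k) / (real b)\<^sup>2) ^ t k * real n ^ (4 * k)) * real b ^ m"
      by (simp only: mult_ac)
    also have "\<dots> \<le> 1 * real b ^ m" by (intro mult_right_mono small k) simp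
    finally show ?thesis by simp
  qed
  \<comment> \<open>The fraction \<open>n^(-2k)\<close> is weakened to \<open>n^(-2)\<close>, using
    \<open>k \<ge> 1\<close>, so that the \<open>n\<close> values of \<open>k\<close> contribute
    \<open>1/n\<close> together.\<close>
  have level: "real (\<Sum>\<pi>\<in>?K k. card (?B k \<pi>)) \<le> real b ^ m / real n ^ 2" if k: "k \<in> {1..n}" for k
  proof -
    have "real (\<Sum>\<pi>\<in>?K k. card (?B k \<pi>)) \<le> (\<Sum>\<pi>\<in>?K k. real b ^ m / real n ^ (4 * k))"
      unfolding of_nat_sum using single[OF k] n2
      by (intro sum_mono) (simp add: pos_le_divide_eq)
    also have "\<dots> = real (card (?K k)) * (real b ^ m / real n ^ (4 * k))" by simp
    also have "\<dots> \<le> real n ^ (2 * k) * (real b ^ m / real n ^ (4 * k))"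
      using card_k_permutations_le[of "{..<n}" k]
      by (intro mult_right_mono) (simp_all flip: of_nat_power)
    also have "\<dots> = real b ^ m / real n ^ (2 * k)"
    proof -
      have "real n ^ (4 * k) = real n ^ (2 * k) * real n ^ (2 * k)" by (simp flip: power_add)
      then show ?thesis using n2 by simp
    qed
    also have "\<dots> \<le> real b ^ m / real n ^ 2"
      using n2 k by (intro divide_left_mono power_increasing) auto
    finally show ?thesis .
  qed
  have "card ?O \<le> card (\<Union>k\<in>{1..n}. \<Union>\<pi>\<in>?K k. ?B k \<pi>)"
    using finK by (intro card_mono cover) (auto intro!: finite_PiE)
  also have "\<dots> \<le> (\<Sum>k\<in>{1..n}. card (\<Union>\<pi>\<in>?K k. ?B k \<pi>))" by (rule card_UN_le) simp
  also have "\<dots> \<le> (\<Sum>k\<in>{1..n}. \<Sum>\<pi>\<in>?K k. card (?B k \<pi>))"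
    by (intro sum_mono card_UN_le finK)
  finally have "real (card ?O) \<le> real (\<Sum>k\<in>{1..n}. \<Sum>\<pi>\<in>?K k. card (?B k \<pi>))"
    by (rule of_nat_mono)
  also have "\<dots> = (\<Sum>k\<in>{1..n}. real (\<Sum>\<pi>\<in>?K k. card (?B k \<pi>)))" by (rule of_nat_sum)
  also have "\<dots> \<le> (\<Sum>k\<in>{1..n}. real b ^ m / real n ^ 2)" by (intro sum_mono level)
  also have "\<dots> = real b ^ m / real n" using n2 by (simp add: power2_eq_square)
  finally have "real b ^ m \<le> real b ^ m / real n" by (simp add: card_PiE)
  moreover have "real b ^ m > 0" using b by simp
  ultimately show False using n2 by (simp add: field_simps)
qed

section \<open>From few overlaps to large distance\<close>

text \<open>\<open>E\<close> and its image have the same size, so their two differences do too, and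
  the image minus \<open>E\<close> consists of the images of the edges leaving
  \<open>E\<close>.\<close>

lemma graph_dist_permute_eq:
  assumes "simple_graph V E" "\<pi> permutes V"
  shows "graph_dist V E (permute_graph \<pi> E) = real (card {e \<in> E. \<pi> ` e \<notin> E})"
proof -
  have inj: "inj ((`) \<pi>)" using permutes_inj[OF assms(2)] by (simp add: inj_image_eq_iff inj_on_def)
  have finE: "finite E" using assms(1)
    by (auto simp: simple_graph_def vertex_pairs_def intro: finite_subset[of _ "Pow V"])
  note p = simple_graph_permute_graph[OF assms]
  have "card (E - permute_graph \<pi> E) = card (permute_graph \<pi> E - E)"
    using finE p(2) unfolding permute_graph_def
    by (simp add: card_Diff_subset_Int Int_commute)
  also have "permute_graph \<pi> E - E = (`) \<pi> ` {e \<in> E. \<pi> ` e \<notin> E}" by (auto simp: permute_graph_def)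
  also have "card \<dots> = card {e \<in> E. \<pi> ` e \<notin> E}" using inj by (intro card_image) (auto intro: inj_on_subset)
  finally show ?thesis using graph_dist_eq_card_diff[OF assms(1) p(1)] p(2) by simp
qed

text \<open>At least \<open>m div n * k\<close> edges are owned by moved vertices. Each leaves the
  graph, is mapped to itself (at most \<open>k\<close> of them), or goes to another edge. The last
  kind numbers at most \<open>3 * t\<close>, since an independent third with \<open>t\<close>
  elements would be an overlap.\<close>

lemma dist_ge_of_no_overlap:
  assumes b: "2 * (Suc (m div n) * b) < n" and w: "w \<in> {..<m} \<rightarrow>\<^sub>E {..<b}"
    and \<pi>: "k_permutation k {..<n} \<pi>" and no: "\<not> overlap n m b t \<pi> w"
  shows "real (m div n * k) - real (k + 3 * t)
    \<le> graph_dist {..<n} (slot_graph n m b w) (permute_graph \<pi> (slot_graph n m b w))"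
proof -
  let ?E = "slot_graph n m b w"
  define S where "S = {v \<in> {..<n}. \<pi> v \<noteq> v}"
  have perm: "\<pi> permutes {..<n}" and cS: "card S = k"
    using \<pi> by (auto simp: k_permutation_def S_def)
  have inj: "inj ((`) \<pi>)" using permutes_inj[OF perm] by (simp add: inj_image_eq_iff inj_on_def)
  define F where "F = (\<lambda>s. slot_pair n b s (w s)) ` slots_of n m S"
  have FE: "F \<subseteq> ?E" by (auto simp: F_def slot_graph_def slots_of_def)
  have FQ: "F \<subseteq> pairs_of n m b S" using w
    by (auto simp: F_def pairs_of_def slots_of_def PiE_iff)
  have finF: "finite F" by (simp add: F_def slots_of_def)
  have "inj_on (\<lambda>s. slot_pair n b s (w s)) (slots_of n m S)"
    using inj_on_choice[OF inj_on_slot_pair[OF b] w]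
    by (rule inj_on_subset) (auto simp: slots_of_def)
  then have cF: "m div n * k \<le> card F"
    using card_slots_of(1)[of n S m] b cS by (auto simp: F_def card_image S_def)
  define P where "P = {e \<in> F. \<pi> ` e \<in> ?E \<and> \<pi> ` e \<noteq> e}"
  \<comment> \<open>The owner \<open>i\<close> of such an edge is moved but stays inside the edge,
    so the other end is \<open>\<pi> i\<close>.\<close>
  have "{e \<in> F. \<pi> ` e = e} \<subseteq> (\<lambda>i. {i, \<pi> i}) ` S"
  proof
    fix e assume "e \<in> {e \<in> F. \<pi> ` e = e}"
    then obtain s where s: "s mod n \<in> S" "e = slot_pair n b s (w s)" "\<pi> ` e = e"
      by (auto simp: F_def slots_of_def)
    then have "e = {s mod n, \<pi> (s mod n)}"
      unfolding slot_pair_def S_def by (auto simp: doubleton_eq_iff)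
    then show "e \<in> (\<lambda>i. {i, \<pi> i}) ` S" using s(1) by blast
  qed
  then have fixed: "card {e \<in> F. \<pi> ` e = e} \<le> k"
    using surj_card_le[of S] cS by (simp add: S_def)
  have "card P \<le> 3 * t"
  proof -
    have "finite P" using finF by (simp add: P_def)
    then have "\<exists>R\<subseteq>P. R \<inter> (`) \<pi> ` R = {} \<and> card P \<le> 3 * card R"
      by (rule inj_fixpoint_free_independent_third[OF _ inj]) (simp add: P_def)
    then obtain R where R: "R \<subseteq> P" "R \<inter> (`) \<pi> ` R = {}" "card P \<le> 3 * card R"
      by blast
    have "card R < t"
    proof (rule ccontr)
      assume "\<not> card R < t"
      then obtain R' where R': "R' \<subseteq> R" "card R' = t"
        by (metis not_less obtain_subset_with_card_n)
      have "overlap n m b t \<pi> w" unfolding overlap_def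
      proof (intro exI[of _ R'] conjI)
        show "R' \<subseteq> pairs_of n m b {v \<in> {..<n}. \<pi> v \<noteq> v}"
          using R' R FQ by (auto simp: P_def S_def)
        show "R' \<inter> (`) \<pi> ` R' = {}" using R R' by blast
        show "R' \<union> (`) \<pi> ` R' \<subseteq> ?E" using R R' FE by (auto simp: P_def)
      qed (fact R')
      with no show False ..
    qed
    then show ?thesis using R(3) by simp
  qed
  have "card F \<le> card ({e \<in> ?E. \<pi> ` e \<notin> ?E} \<union> ({e \<in> F. \<pi> ` e = e} \<union> P))"
    using FE finF by (intro card_mono) (auto simp: P_def slot_graph_def)
  also have "\<dots> \<le> card {e \<in> ?E. \<pi> ` e \<notin> ?E} + (card {e \<in> F. \<pi> ` e = e} + card P)"
    by (meson add_left_mono card_Un_le order_trans)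
  finally have "m div n * k \<le> card {e \<in> ?E. \<pi> ` e \<notin> ?E} + (k + 3 * t)"
    using cF fixed \<open>card P \<le> 3 * t\<close> by linarith
  then have "real (m div n * k) \<le> real (card {e \<in> ?E. \<pi> ` e \<notin> ?E}) + real (k + 3 * t)"
    by linarith
  then show ?thesis using graph_dist_permute_eq[OF slot_graph(1)[OF b w] perm] by linarith
qed

section \<open>Numerical estimates\<close>

text \<open>The 12 is a product of three losses: 3 for \<open>(n - 1) div 2\<close> against
  \<open>n\<close>, 2 for \<open>Suc r\<close> against \<open>r\<close>, and 2 for the last
  rounding, which costs at most one and is absorbed by \<open>n \<ge> 12 * r\<close>.\<close>

lemma block_size_ge:
  fixes n r :: nat
  assumes "r \<ge> 1" "n \<ge> 12 * r"
  shows "real n / (12 * real r) \<le> real ((n - 1) div 2 div Suc r)"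
proof -
  let ?h = "(n - 1) div 2" and ?b = "(n - 1) div 2 div Suc r"
  have "n \<le> 3 * ?h" using assms by linarith
  moreover have "?h \<le> (?b + 1) * Suc r"
    using dividend_less_div_times[of "Suc r" ?h] unfolding distrib_right by simp
  then have "real ?h \<le> real ((?b + 1) * Suc r)" by (rule of_nat_mono)
  then have "real ?h \<le> (real ?b + 1) * (real r + 1)"
    by (simp only: of_nat_mult of_nat_add of_nat_Suc of_nat_1 add.commute)
  moreover have "(real ?b + 1) * (real r + 1) \<le> (real ?b + 1) * (2 * real r)"
    using assms by (intro mult_left_mono) auto
  ultimately have "real n \<le> 6 * real r * (real ?b + 1)" by (simp add: algebra_simps)
  moreover have "12 * real r \<le> real n" using assms by (metis of_nat_le_iff of_nat_mult of_nat_numeral)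
  ultimately have "real n \<le> 12 * real r * real ?b" by (simp add: algebra_simps)
  then show ?thesis using assms by (simp add: field_simps)
qed

text \<open>With $y = n/r$ this says $r \ln (n/r) \ge M \ln n$: it covers the sparse and the dense extreme at
  once.\<close>

lemma ln_ratio_ge:
  fixes M r y :: real
  assumes "M \<ge> 1" "r \<ge> 16 * M\<^sup>2" "y \<ge> 3"
  shows "M * (ln r + ln y) \<le> r * ln y"
proof -
  have M: "M \<le> M\<^sup>2" using assms(1) by (simp add: power2_eq_square)
  have r: "r > 0" "r \<ge> 2 * M" using assms(1,2) M by auto
  have "ln y \<ge> 1" using assms(3) exp_le ln_ge_iff[of y 1] by linarith
  have "sqrt r \<ge> 4 * M" using assms(1,2) by (intro real_le_rsqrt) (simp add: power_mult_distrib)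
  \<comment> \<open>Half of \<open>r * ln y\<close> absorbs \<open>M * ln r\<close>, the other half
    \<open>M * ln y\<close>. Passing to \<open>sqrt r\<close> gives
    \<open>ln r \<le> 2 * sqrt r\<close>, and \<open>4 * M \<le> sqrt r\<close> then
    suffices.\<close>
  have "ln r = 2 * ln (sqrt r)" using r by (simp add: ln_sqrt)
  also have "\<dots> \<le> 2 * sqrt r" using ln_bound[of "sqrt r"] r by simp
  finally have "M * ln r \<le> M * (2 * sqrt r)" using assms(1) by (intro mult_left_mono) auto
  also have "\<dots> = (4 * M) * sqrt r / 2" by simp
  also have "\<dots> \<le> sqrt r * sqrt r / 2"
    using \<open>sqrt r \<ge> 4 * M\<close> r by (intro divide_right_mono mult_right_mono) auto
  also have "\<dots> = r / 2" using r by simp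
  also have "\<dots> \<le> r / 2 * ln y" using r \<open>ln y \<ge> 1\<close> by simp
  finally have "M * ln r \<le> r / 2 * ln y" .
  moreover have "M * ln y \<le> r / 2 * ln y" using r \<open>ln y \<ge> 1\<close> by (intro mult_right_mono) auto
  ultimately show ?thesis by (simp add: algebra_simps)
qed

text \<open>With \<open>y = n/r\<close>, the base is at most a constant over
  \<open>\<epsilon> * y\<close>, hence at most \<open>y\<close> to the power \<open>-1/2\<close> for
  large \<open>y\<close>. Since \<open>t\<close> is at least \<open>\<epsilon> * r * k / 6\<close>,
  \<open>ln_ratio_ge\<close> makes the \<open>t\<close>-th power outweigh
  \<open>n ^ (4 * k)\<close>.\<close>

lemma overlap_weight_small:
  fixes \<epsilon> :: real and n r k t :: nat
  defines "b \<equiv> (n - 1) div 2 div Suc r"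
  assumes eps: "0 < \<epsilon>" "\<epsilon> \<le> 1" and r: "real r \<ge> 200000 / \<epsilon>\<^sup>2" and n: "real n \<ge> 200000 / \<epsilon>\<^sup>2 * real r"
    and k: "k \<ge> 1" and t: "real t \<ge> \<epsilon> * real r * real k / 6"
  shows "(exp 1 * real (Suc r * k * b) / real t / (real b)\<^sup>2) ^ t * real n ^ (4 * k) \<le> 1"
proof -
  have "200000 \<le> 200000 / \<epsilon>\<^sup>2" using eps by (simp add: field_simps power_le_one)
  then have big: "real r \<ge> 200000" "real n \<ge> 200000 * real r"
    using r n mult_right_mono[of 200000 "200000 / \<epsilon>\<^sup>2" "real r"] by linarith+
  define y where "y = real n / real r"
  have y: "y \<ge> 200000 / \<epsilon>\<^sup>2" "y \<ge> 200000" using n big by (simp_all add: y_def pos_le_divide_eq)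
  have b: "y / 12 \<le> real b" unfolding b_def y_def using block_size_ge[of r n] big by simp
  then have b0: "real b > 0" using y by linarith
  have rk0: "real r * real k > 0" using big k by simp
  then have erk: "\<epsilon> * real r * real k > 0" using eps by (simp add: mult.assoc)
  then have t0: "real t > 0" using t by linarith
  have sq: "exp (ln y / 2) = sqrt y" using y by (simp flip: ln_sqrt)
  define z where "z = exp 1 * real (Suc r * k * b) / real t / (real b)\<^sup>2"
  have "z = exp 1 * ((1 + real r) * real k) / (real t * real b)"
    using b0 t0 by (simp add: z_def power2_eq_square frac_eq_eq) (simp add: algebra_simps)
  \<comment> \<open>Here \<open>exp 1 \<le> 3\<close> and \<open>Suc r \<le> 2 * r\<close>; the
    constant becomes \<open>432 = 3 * 2 * 6 * 12\<close>.\<close>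
  also have "\<dots> \<le> 3 * (2 * real r * real k) / ((\<epsilon> * real r * real k / 6) * (y / 12))"
    using t b y erk exp_le big k by (intro frac_le mult_mono) auto
  also have "\<dots> = (432 / \<epsilon>) / y" using big k eps y by (simp add: field_simps)
  \<comment> \<open>Half of the power of \<open>y\<close> pays for the constant. The number 200000
    is a round bound above \<open>432^2 = 186624\<close>.\<close>
  also have "\<dots> \<le> sqrt y / y"
  proof (rule divide_right_mono)
    have "(432 / \<epsilon>)\<^sup>2 \<le> 200000 / \<epsilon>\<^sup>2" by (simp add: power_divide divide_right_mono)
    then show "432 / \<epsilon> \<le> sqrt y" using y by (intro real_le_rsqrt) linarith
  qed (use y in simp)
  also have "\<dots> = exp (- (ln y / 2))"
    using y sq by (simp add: exp_minus sqrt_divide_self_eq)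
  finally have z: "z \<le> exp (- (ln y / 2))" .
  have "z \<ge> 0" by (simp add: z_def)
  \<comment> \<open>The goal \<open>4 * k * ln n \<le> (\<epsilon> * r * k / 6) * (ln y / 2)\<close>
    amounts to \<open>48 * ln n \<le> \<epsilon> * r * ln y\<close>, which dictates
    \<open>M = 48 / \<epsilon>\<close>.\<close>
  have "48 / \<epsilon> * (ln (real r) + ln y) \<le> real r * ln y"
  proof (rule ln_ratio_ge)
    have "16 * (48 / \<epsilon>)\<^sup>2 \<le> 200000 / \<epsilon>\<^sup>2" by (simp add: power_divide divide_right_mono)
    then show "16 * (48 / \<epsilon>)\<^sup>2 \<le> real r" using r by linarith
  qed (use eps y in \<open>auto simp: field_simps\<close>)
  moreover have "ln (real n) = ln (real r) + ln y"
    using big by (simp add: y_def ln_div)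
  ultimately have L: "48 * ln (real n) \<le> \<epsilon> * real r * ln y" using eps by (simp add: field_simps)
  have "4 * real k * ln (real n) = real k / 12 * (48 * ln (real n))" by simp
  also have "\<dots> \<le> real k / 12 * (\<epsilon> * real r * ln y)" by (intro mult_left_mono L) simp
  also have "\<dots> = (\<epsilon> * real r * real k / 6) * (ln y / 2)" by simp
  also have "\<dots> \<le> real t * (ln y / 2)" using y by (intro mult_right_mono t) simp
  finally have exponent: "4 * real k * ln (real n) \<le> real t * (ln y / 2)" .
  have "z ^ t * real n ^ (4 * k) \<le> exp (- (ln y / 2)) ^ t * exp (ln (real n)) ^ (4 * k)"
    using z \<open>z \<ge> 0\<close> big by (intro mult_mono power_mono) auto
  also have "\<dots> = exp (real t * - (ln y / 2) + real (4 * k) * ln (real n))"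
    by (simp only: exp_of_nat_mult exp_add)
  also have "\<dots> \<le> 1" using exponent by simp
  finally show ?thesis unfolding z_def .
qed

section \<open>Choice of parameters and conclusion\<close>

theorem theorem1:
  fixes \<delta> :: real
  assumes "0 < \<delta>" and "\<delta> < 1"
  shows "\<exists>c::real. c > 0 \<and>
           (\<forall>n m :: nat. c * real n \<le> real m \<and> real m \<le> (real n)\<^sup>2 / c \<longrightarrow>
              (\<exists>(V :: nat set) E. simple_graph V E \<and> card V = n \<and> card E = m \<and>
                 asymmetric_graph \<delta> V E))"
proof -
  \<comment> \<open>The slack \<open>1 - \<delta>\<close> is split in two: one
    \<open>\<epsilon>\<close> pays for the fixed and overlapping edges, the other for
    \<open>m\<close> exceeding \<open>r * n\<close>.\<close>
  define \<epsilon> where "\<epsilon> = (1 - \<delta>) / 2"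
  have eps: "0 < \<epsilon>" "\<epsilon> \<le> 1" "\<epsilon> + \<epsilon> + \<delta> = 1" using assms by (auto simp: \<epsilon>_def field_simps)
  \<comment> \<open>Rounding up to an integer lets \<open>c * n \<le> m\<close> pass to the quotient
    \<open>m div n\<close>.\<close>
  define c where "c = nat \<lceil>200000 / \<epsilon>\<^sup>2\<rceil>"
  have c: "real c \<ge> 200000 / \<epsilon>\<^sup>2" by (simp add: c_def real_nat_ceiling_ge)
  have "200000 / \<epsilon>\<^sup>2 \<ge> 200000 / \<epsilon>" using eps by (simp add: field_simps power2_eq_square)
  moreover have "200000 / \<epsilon> \<ge> 200000" using eps by (simp add: field_simps)
  moreover have "8 / \<epsilon> \<le> 200000 / \<epsilon>" using eps by (intro divide_right_mono) auto
  ultimately have ceps: "real c \<ge> 8 / \<epsilon>" "real c \<ge> 200000"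
    using c by linarith+
  have "\<exists>(V :: nat set) E. simple_graph V E \<and> card V = n \<and> card E = m \<and> asymmetric_graph \<delta> V E"
    if m: "real c * real n \<le> real m" "real m \<le> (real n)\<^sup>2 / real c" for n m :: nat
  \<comment> \<open>For \<open>n = 0\<close> the bounds force \<open>m = 0\<close>, and no
    \<open>k\<close> is left to check.\<close>
  proof (cases "n = 0")
    case True
    then show ?thesis using m
      by (intro exI[of _ "{}"]) (auto simp: simple_graph_def asymmetric_graph_def)
  next
    case False
    define r where "r = m div n"
    \<comment> \<open>The largest size for which \<open>Suc r\<close> blocks fit into the
      \<open>(n - 1) div 2\<close> steps shorter than \<open>n/2\<close>.\<close>
    define b where "b = (n - 1) div 2 div Suc r"
    \<comment> \<open>The loss \<open>3 * t\<close> is then about half of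
      \<open>\<epsilon> * r * k\<close>; the other half is kept for the \<open>k\<close> swapped
      pairs and the rounding of \<open>t\<close>.\<close>
    define t where "t k = nat \<lceil>\<epsilon> * real r * real k / 6\<rceil>" for k
    \<comment> \<open>The lower bound on \<open>m\<close> turns into \<open>r \<ge> c\<close>, the
      upper one into \<open>n \<ge> c * r\<close>: many owned edges per vertex, and large
      blocks.\<close>
    have "c * n \<le> m" using m(1) by (metis of_nat_le_iff of_nat_mult)
    then have "c \<le> r" using False by (simp add: r_def less_eq_div_iff_mult_less_eq)
    then have rc: "real r \<ge> real c" by simp
    have "8 / \<epsilon> \<le> real r" using ceps(1) rc by linarith
    then have er8: "8 \<le> \<epsilon> * real r" using eps by (simp add: pos_divide_le_eq mult.commute)
    have "real r * real n \<le> real m" unfolding r_def by (metis div_times_less_eq_dividend of_nat_le_iff of_nat_mult)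
    then have "real r * real n * real c \<le> real n * real n"
      using m(2) ceps by (simp add: pos_le_divide_eq power2_eq_square) (meson mult_right_mono of_nat_0_le_iff order_trans)
    then have nr: "real n \<ge> real c * real r" using False by (simp add: mult.commute)
    have nr': "real n \<ge> 200000 / \<epsilon>\<^sup>2 * real r"
      using nr mult_right_mono[OF c, of "real r"] by linarith
    have r1: "r \<ge> 1" using rc ceps by simp
    have "12 * real r \<le> real n" using nr mult_right_mono[OF ceps(2), of "real r"] by linarith
    then have n12: "12 * r \<le> n" by linarith
    then have "real b > 0" unfolding b_def using block_size_ge[OF r1 n12] r1
      by (smt (verit) divide_pos_pos of_nat_0_less_iff zero_less_mult_iff False not_gr_zero less_le_trans zero_less_one)
    then have b0: "b > 0" by simp
    have "Suc r * b \<le> (n - 1) div 2" unfolding b_def by (rule times_div_less_eq_dividend)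
    then have b: "2 * (Suc (m div n) * b) < n" using False unfolding r_def by linarith
    have t: "real (t k) \<ge> \<epsilon> * real r * real k / 6" "real (t k) < \<epsilon> * real r * real k / 6 + 1" for k
    proof -
      have "0 \<le> \<epsilon> * real r * real k / 6" using eps by simp
      then show "real (t k) \<ge> \<epsilon> * real r * real k / 6" "real (t k) < \<epsilon> * real r * real k / 6 + 1"
        unfolding t_def by linarith+
    qed
    obtain w where w: "w \<in> {..<m} \<rightarrow>\<^sub>E {..<b}"
      and good: "\<And>k \<pi>. k \<in> {1..n} \<Longrightarrow> k_permutation k {..<n} \<pi> \<Longrightarrow> \<not> overlap n m b (t k) \<pi> w"
    proof -
      have "\<exists>w \<in> {..<m} \<rightarrow>\<^sub>E {..<b}. \<forall>k \<in> {1..n}. \<forall>\<pi>. k_permutation k {..<n} \<pi> \<longrightarrow> \<not> overlap n m b (t k) \<pi> w"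
      proof (rule exists_no_overlap[OF b b0])
        fix k assume k: "k \<in> {1..n}"
        have "0 < \<epsilon> * real r * real k / 6" using eps r1 k by simp
        then have "real (t k) > 0" using t(1)[of k] by linarith
        then show "t k > 0" by simp
        have "real r \<ge> 200000 / \<epsilon>\<^sup>2" using c rc by linarith
        then show "(exp 1 * real (Suc (m div n) * k * b) / real (t k) / (real b)\<^sup>2) ^ t k * real n ^ (4 * k) \<le> 1"
          unfolding b_def r_def[symmetric]
          using eps nr' k t by (intro overlap_weight_small[of \<epsilon>]) auto
      qed
      then show ?thesis using that by blast
    qed
    let ?E = "slot_graph n m b w"
    have "asymmetric_graph \<delta> {..<n} ?E"
      unfolding asymmetric_graph_def
    proof (intro ballI allI impI)
      fix k \<pi> assume k: "k \<in> {1..card {..<n}}" and \<pi>: "k_permutation k {..<n} \<pi>"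
      have k1: "real k \<ge> 1" using k by simp
      have "real m \<le> (real r + 1) * real n"
      proof -
        have "m \<le> (r + 1) * n"
          using dividend_less_div_times[of n m] False unfolding r_def distrib_right by simp
        then have "real m \<le> real ((r + 1) * n)" by (rule of_nat_mono)
        then show ?thesis by (simp add: distrib_right)
      qed
      then have "\<delta> * (real k / real n) * real m \<le> \<delta> * (real k / real n) * ((real r + 1) * real n)"
        using assms by (intro mult_left_mono) auto
      also have "\<dots> = real k * (\<delta> * (real r + 1))" using False by simp
      also have "\<dots> \<le> real k * (real r - \<epsilon> * real r)"
      proof (rule mult_left_mono)
        have "real r = (\<epsilon> + \<epsilon> + \<delta>) * real r" using eps(3) by simp
        then have "real r = \<epsilon> * real r + \<epsilon> * real r + \<delta> * real r" by (simp only: distrib_right)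
        then show "\<delta> * (real r + 1) \<le> real r - \<epsilon> * real r"
          using er8 assms(2) unfolding distrib_left by linarith
      qed simp
      \<comment> \<open>Rounding gives \<open>3 * t k < \<epsilon> * r * k / 2 + 3\<close>, and
        \<open>k + 3 \<le> 4 * k \<le> \<epsilon> * r * k / 2\<close> by \<open>er8\<close>.\<close>
      also have "\<dots> \<le> real (m div n * k) - real (k + 3 * t k)"
      proof -
        have "8 * real k \<le> \<epsilon> * real r * real k" by (intro mult_right_mono er8) simp
        moreover have "real k * (real r - \<epsilon> * real r) = real r * real k - \<epsilon> * real r * real k"
          by (simp add: algebra_simps)
        moreover have "real (m div n * k) - real (k + 3 * t k) = real r * real k - real k - 3 * real (t k)"
          by (simp add: r_def)
        ultimately show ?thesis using t(2)[of k] k1 by linarith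
      qed
      also have "\<dots> \<le> graph_dist {..<n} ?E (permute_graph \<pi> ?E)"
        using k by (intro dist_ge_of_no_overlap[OF b w \<pi>] good[OF _ \<pi>]) simp
      finally show "\<delta> * (real k / real (card {..<n})) * real (card ?E)
          \<le> graph_dist {..<n} ?E (permute_graph \<pi> ?E)"
        using slot_graph(2)[OF b w] by simp
    qed
    then show ?thesis using slot_graph[OF b w] by (intro exI[of _ "{..<n}"] exI[of _ ?E]) simp
  qed
  then show ?thesis using ceps by (intro exI[of _ "real c"]) auto
qed

end
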